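(* Let $\tilde f:\mathbb{R}^{n_x}\to\mathbb{R}^{n_x}$ be differentiable, let $T\ge 1$ be an integer, let $L_T(\xi)=\|\tilde f^{(T)}(\xi)\|^2$, and let $H(x,p)=p^\top\tilde f(x)$ for $x,p\in\mathbb{R}^{n_x}$. Fix $\xi\in\mathbb{R}^{n_x}$. Set $x_0=\xi$ and generate the state sequence as $x_{t+1}=\tilde f(x_t)$ for $t=0,1,\ldots,T-1$. Next, set $p_T=2x_T$ and generate the costate sequence in a backward manner by $$p_t=\nabla_x H(x_t,p_{t+1})\quad\text{for } 0\le t\le T-1.$$ Then $\nabla L_T(\xi)=p_0$.
   Context: The setting is a closed-loop system $x_{t+1}=f(x_t,u_t)$ with $u_t=K(h(x_t))$ and state $x_t\in\mathbb{R}^{n_x}$, which reduces to the autonomous form $x_{t+1}=\tilde f(x_t)$ with $\tilde f(x)=f(x,K(h(x)))$. The iterates of $\tilde f$ are defined by $\tilde f^{(0)}=\mathrm{id}$ and $\tilde f^{(n+1)}=\tilde f\circ\tilde f^{(n)}$, so that $x_t=\tilde f^{(t)}(x_0)$. The norm $\|\cdot\|$ is the Euclidean norm, gradients are column vectors, and $\nabla_x H$ denotes the gradient of $H(x,p)$ with respect to its first argument $x$. *)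

theory Defs
  imports "HOL-Analysis.Analysis"
begin

definition terminal_loss :: "(real ^ 'n \<Rightarrow> real ^ 'n) \<Rightarrow> nat \<Rightarrow> real ^ 'n \<Rightarrow> real" where
  "terminal_loss f T \<xi> = (norm ((f ^^ T) \<xi>))\<^sup>2"

definition hamiltonian :: "(real ^ 'n \<Rightarrow> real ^ 'n) \<Rightarrow> real ^ 'n \<Rightarrow> real ^ 'n \<Rightarrow> real" where
  "hamiltonian f x p = p \<bullet> f x"

end

theory Submission
  imports Defs
begin

text \<open>
  The costate \<open>p t\<close> is the gradient at \<open>x t\<close> of the cost-to-go
  \<open>\<lambda>y. (norm ((f ^^ (T - t)) y))\<^sup>2\<close>, that is, of the loss over the remaining \<open>T - t\<close> steps.
  This is proved by backward induction on \<open>t\<close>. At \<open>t = T\<close> the cost-to-go is the squared norm,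
  with gradient \<open>2 *\<^sub>R x T\<close>. For the step, the cost-to-go at \<open>t\<close> is the one at \<open>Suc t\<close> composed
  with \<open>f\<close>, and by the chain rule its gradient depends on the outer function only through the
  gradient \<open>p (Suc t)\<close>; the outer function may hence be replaced by its linear part
  \<open>z \<mapsto> p (Suc t) \<bullet> z\<close> (lemma \<open>gderiv_compose_linearised\<close>), and this turns the composition into
  the Hamiltonian. The claim is the case \<open>t = 0\<close>.
\<close>

lemma gderiv_norm_squared:
  fixes x :: "'a::real_inner"
  shows "GDERIV (\<lambda>y. (norm y)\<^sup>2) x :> 2 *\<^sub>R x"
proof -
  have "((\<lambda>y. y \<bullet> y) has_derivative (\<lambda>h. x \<bullet> h + h \<bullet> x)) (at x)"
    by (intro has_derivative_inner has_derivative_ident)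
  then show ?thesis
    by (simp add: gderiv_def power2_norm_eq_inner inner_commute)
qed

text \<open>
  Without the differentiability of \<open>f\<close> the lemma fails: the scalar function \<open>y \<mapsto> q \<bullet> f y\<close> says
  nothing about the components of \<open>f\<close> orthogonal to \<open>q\<close>.
\<close>

lemma gderiv_compose_linearised:
  fixes f :: "'a::real_inner \<Rightarrow> 'b::real_inner"
  assumes f: "f differentiable (at x)"
    and g: "GDERIV g (f x) :> q"
    and lin: "GDERIV (\<lambda>y. q \<bullet> f y) x :> d"
  shows "GDERIV (\<lambda>y. g (f y)) x :> d"
proof -
  obtain f' where f': "(f has_derivative f') (at x)"
    using f by (auto simp: differentiable_def)
  have "((\<lambda>y. q \<bullet> f y) has_derivative (\<lambda>h. q \<bullet> f' h)) (at x)"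
    using f' by (rule has_derivative_inner_right)
  then have "(\<lambda>h. q \<bullet> f' h) = (\<lambda>h. h \<bullet> d)"
    using lin unfolding gderiv_def by (rule has_derivative_unique)
  moreover have "((\<lambda>y. g (f y)) has_derivative (\<lambda>h. f' h \<bullet> q)) (at x)"
    using has_derivative_compose[OF f'] g unfolding gderiv_def by blast
  ultimately show ?thesis
    by (simp add: gderiv_def inner_commute)
qed

theorem lemma5:
  fixes f :: "real ^ 'n \<Rightarrow> real ^ 'n"
    and T :: nat
    and \<xi> :: "real ^ 'n"
    and x p :: "nat \<Rightarrow> real ^ 'n"
  assumes "f differentiable_on UNIV"
    and "T \<ge> 1"
    and "x 0 = \<xi>"
    and "\<And>t. t < T \<Longrightarrow> x (Suc t) = f (x t)"
    and "p T = 2 *\<^sub>R x T"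
    and "\<And>t. t < T \<Longrightarrow> GDERIV (\<lambda>y. hamiltonian f y (p (Suc t))) (x t) :> p t"
  shows "GDERIV (terminal_loss f T) \<xi> :> p 0"
proof -
  have cost_to_go: "GDERIV (terminal_loss f (T - t)) (x t) :> p t" if "t \<le> T" for t
    using that
  proof (induction t rule: inc_induct)
    case base
    then show ?case
      using gderiv_norm_squared[of "x T"] assms(5)
      by (simp add: terminal_loss_def[abs_def])
  next
    case (step t)
    have "f differentiable (at (x t))"
      using assms(1) by (simp add: differentiable_on_def)
    moreover have "GDERIV (terminal_loss f (T - Suc t)) (f (x t)) :> p (Suc t)"
      using step.IH assms(4)[OF step.hyps(2)] by simp
    moreover have "GDERIV (\<lambda>y. p (Suc t) \<bullet> f y) (x t) :> p t"
      using assms(6)[OF step.hyps(2)] by (simp add: hamiltonian_def)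
    ultimately have "GDERIV (\<lambda>y. terminal_loss f (T - Suc t) (f y)) (x t) :> p t"
      by (rule gderiv_compose_linearised)
    moreover have "T - t = Suc (T - Suc t)"
      using step.hyps(2) by simp
    then have "terminal_loss f (T - t) = (\<lambda>y. terminal_loss f (T - Suc t) (f y))"
      by (simp add: terminal_loss_def fun_eq_iff funpow_swap1)
    ultimately show ?case
      by simp
  qed
  show ?thesis
    using cost_to_go[of 0] assms(3) by simp
qed

end
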